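(* Let $n\ge 1$, let $\mathbf{x}=(x_0,x_1,\dots,x_n)\in\mathcal{X}^{n+1}$ be any sequence of contexts, and let $\pi$ be any non-decreasing separable policy. Then $$ \mathsf{Reg}_n(\pi,\mathbf{x})=\max\Big\{\sup_{\mu_0\in[0,1-q]}\mathbb{E}_{\mathbf{y}\sim\mathcal{B}(\mu_0+d(x_0,x_1))\times\cdots\times\mathcal{B}(\mu_0+d(x_0,x_n))}\big[R(\pi(\mathbf{x},\mathbf{y}),\mathcal{B}(\mu_0))\big],\ \sup_{\mu_0\in[1-q,1]}\mathbb{E}_{\mathbf{y}\sim\mathcal{B}(\mu_0-d(x_0,x_1))\times\cdots\times\mathcal{B}(\mu_0-d(x_0,x_n))}\big[R(\pi(\mathbf{x},\mathbf{y}),\mathcal{B}(\mu_0))\big]\Big\}. $$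
   Context: Let $\mathcal{Y}=[0,1]$ and let $\Delta(\mathcal{Y})$ be the set of probability distributions on $\mathcal{Y}$; an element $F\in\Delta(\mathcal{Y})$ is identified with its cumulative distribution function (cdf). Let $\mathcal{X}$ be a set (of contexts) and $d:\mathcal{X}\times\mathcal{X}\to\mathbb{R}$ a non-negative function (the dissimilarity). Costs $c_o,c_u>0$ satisfy $c_o+c_u=1$, and $q=c_u/(c_u+c_o)$. Newsvendor loss: $\ell(a,y)=c_o(a-y)^+ + c_u(y-a)^+$ for $a,y\in\mathcal{Y}$, where $z^+=\max(0,z)$. For $a\in\mathcal{Y}$, $F_0\in\Delta(\mathcal{Y})$: $L(a,F_0)=\mathbb{E}_{y\sim F_0}[\ell(a,y)]$, $a^*_{F_0}=\inf\{a\in\mathcal{Y}: F_0(a)\ge q\}$, $R(a,F_0)=L(a,F_0)-L(a^*_{F_0},F_0)$. For $\nu\in\Delta(\mathcal{Y})$: $L(\nu,F_0)=\mathbb{E}_{a\sim\nu}[L(a,F_0)]$ and $R(\nu,F_0)=L(\nu,F_0)-L(a^*_{F_0},F_0)$. A data-driven policy (possibly randomized) is a map $\pi:\mathcal{X}^{n+1}\times\mathcal{Y}^n\to\Delta(\mathcal{Y})$, $(\mathbf{x},\mathbf{y})\mapsto\pi(\mathbf{x},\mathbf{y})$, measurable in $\mathbf{y}$ so that all expectations below make sense. The contexts $\mathbf{x}$ are fixed. Separable policy: $\pi$ is separable if there is a function $P^\pi:[0,1]^n\to[0,1]$ (possibly depending on the fixed $\mathbf{x}$) such that for all $F_1,\dots,F_n\in\Delta(\mathcal{Y})$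 and all $y\in\mathbb{R}$, $$\mathbb{P}_{\mathbf{y}\sim F_1\times\cdots\times F_n,\ a\sim\pi(\mathbf{x},\mathbf{y})}(a\le y)=P^\pi(F_1(y),\dots,F_n(y)).$$ It is non-decreasing separable if in addition $P^\pi$ is non-decreasing in each coordinate (the other coordinates being fixed in $[0,1]$). Kolmogorov distance: $\|F-F'\|_K=\sup_{y\in\mathbb{R}}|F(y)-F'(y)|$. Worst-case regret: $$\mathsf{Reg}_n(\pi,\mathbf{x})=\sup_{F_0\in\Delta(\mathcal{Y})}\ \sup_{\substack{F_1,\dots,F_n\in\Delta(\mathcal{Y})\\ \|F_0-F_i\|_K\le d(x_0,x_i)\ \forall i\in\{1,\dots,n\}}}\mathbb{E}_{\mathbf{y}\sim F_1\times\cdots\times F_n}\big[R(\pi(\mathbf{x},\mathbf{y}),F_0)\big].$$ For $\mu\in\mathbb{R}$, $\mathcal{B}(\mu)$ denotes the Bernoulli distribution on $\{0,1\}$ with mean $\min(\max(\mu,0),1)$. *)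

theory Defs
  imports "HOL-Probability.Probability"
begin

definition unit_borel :: "real measure" where
  "unit_borel = restrict_space borel {0..1}"

definition Delta :: "real measure set" where
  "Delta = space (prob_algebra unit_borel)"

text \<open>
  The space of an element of \<open>Delta\<close> is the unit interval, so \<open>{..y}\<close> is in general not
  one of its measurable sets and the library constant \<^const>\<open>cdf\<close> does not apply directly;
  the lemma below relates the two. The argument \<open>y\<close> ranges over all reals.
\<close>

definition cdf_unit :: "real measure \<Rightarrow> real \<Rightarrow> real" where
  "cdf_unit F y = \<P>(a in F. a \<le> y)"

lemma cdf_unit_eq_cdf:
  assumes "F \<in> Delta"
  shows "cdf_unit F y = cdf (distr F borel (\<lambda>a. a)) y"
proof -
  have sets: "sets F = sets unit_borel"
    using assms by (simp add: Delta_def space_prob_algebra)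
  have "(\<lambda>a. a) \<in> measurable F borel"
    unfolding measurable_cong_sets[OF sets refl] unit_borel_def
    by (rule measurable_restrict_space1) simp
  then have "measure (distr F borel (\<lambda>a. a)) {..y} = measure F ((\<lambda>a. a) -` {..y} \<inter> space F)"
    by (rule measure_distr) simp
  also have "(\<lambda>a. a) -` {..y} \<inter> space F = {a \<in> space F. a \<le> y}"
    by auto
  finally show ?thesis
    by (simp add: cdf_unit_def cdf_def)
qed

definition kolmogorov_dist :: "real measure \<Rightarrow> real measure \<Rightarrow> real" where
  "kolmogorov_dist F F' = (SUP y. \<bar>cdf_unit F y - cdf_unit F' y\<bar>)"

definition critical_ratio :: "real \<Rightarrow> real \<Rightarrow> real" where
  "critical_ratio c\<^sub>o c\<^sub>u = c\<^sub>u / (c\<^sub>u + c\<^sub>o)"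

definition nv_loss :: "real \<Rightarrow> real \<Rightarrow> real \<Rightarrow> real \<Rightarrow> real" where
  "nv_loss c\<^sub>o c\<^sub>u a y = c\<^sub>o * max 0 (a - y) + c\<^sub>u * max 0 (y - a)"

definition action_loss :: "real \<Rightarrow> real \<Rightarrow> real \<Rightarrow> real measure \<Rightarrow> real" where
  "action_loss c\<^sub>o c\<^sub>u a F\<^sub>0 = (\<integral>y. nv_loss c\<^sub>o c\<^sub>u a y \<partial>F\<^sub>0)"

definition opt_action :: "real \<Rightarrow> real \<Rightarrow> real measure \<Rightarrow> real" where
  "opt_action c\<^sub>o c\<^sub>u F\<^sub>0 = Inf {a \<in> {0..1}. cdf_unit F\<^sub>0 a \<ge> critical_ratio c\<^sub>o c\<^sub>u}"

definition mixed_loss :: "real \<Rightarrow> real \<Rightarrow> real measure \<Rightarrow> real measure \<Rightarrow> real" where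
  "mixed_loss c\<^sub>o c\<^sub>u \<nu> F\<^sub>0 = (\<integral>a. action_loss c\<^sub>o c\<^sub>u a F\<^sub>0 \<partial>\<nu>)"

definition mixed_regret :: "real \<Rightarrow> real \<Rightarrow> real measure \<Rightarrow> real measure \<Rightarrow> real" where
  "mixed_regret c\<^sub>o c\<^sub>u \<nu> F\<^sub>0 =
     mixed_loss c\<^sub>o c\<^sub>u \<nu> F\<^sub>0 - action_loss c\<^sub>o c\<^sub>u (opt_action c\<^sub>o c\<^sub>u F\<^sub>0) F\<^sub>0"

text \<open>
  Tuples are extensional functions: context sequences are indexed by \<open>{0..n}\<close>, samples by
  \<open>{1..n}\<close>. A policy is a Markov kernel in the samples for every context sequence.
\<close>

definition contexts :: "nat \<Rightarrow> (nat \<Rightarrow> 'x) set" where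
  "contexts n = {0..n} \<rightarrow>\<^sub>E UNIV"

definition is_policy :: "nat \<Rightarrow> ((nat \<Rightarrow> 'x) \<Rightarrow> (nat \<Rightarrow> real) \<Rightarrow> real measure) \<Rightarrow> bool" where
  "is_policy n \<pi> \<longleftrightarrow>
     (\<forall>xs\<in>contexts n. \<pi> xs \<in> Pi\<^sub>M {1..n} (\<lambda>_. unit_borel) \<rightarrow>\<^sub>M prob_algebra unit_borel)"

text \<open>
  The monadic bind below is the law of \<open>a\<close> when the samples are independent with laws
  \<open>F 1, \<dots>, F n\<close> and \<open>a\<close> is then drawn from the policy.
\<close>

definition separable_via ::
  "nat \<Rightarrow> ((nat \<Rightarrow> 'x) \<Rightarrow> (nat \<Rightarrow> real) \<Rightarrow> real measure) \<Rightarrow> (nat \<Rightarrow> 'x) \<Rightarrow>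
    ((nat \<Rightarrow> real) \<Rightarrow> real) \<Rightarrow> bool" where
  "separable_via n \<pi> xs P \<longleftrightarrow>
     P \<in> ({1..n} \<rightarrow>\<^sub>E {0..1}) \<rightarrow> {0..1} \<and>
     (\<forall>F \<in> {1..n} \<rightarrow> Delta. \<forall>y.
        \<P>(a in Pi\<^sub>M {1..n} F \<bind> \<pi> xs. a \<le> y) = P (\<lambda>i\<in>{1..n}. cdf_unit (F i) y))"

definition coordinatewise_mono :: "nat \<Rightarrow> ((nat \<Rightarrow> real) \<Rightarrow> real) \<Rightarrow> bool" where
  "coordinatewise_mono n P \<longleftrightarrow>
     (\<forall>p \<in> {1..n} \<rightarrow>\<^sub>E {0..1}. \<forall>i\<in>{1..n}. mono_on {0..1} (\<lambda>t. P (p(i := t))))"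

definition nondecreasing_separable ::
  "nat \<Rightarrow> ((nat \<Rightarrow> 'x) \<Rightarrow> (nat \<Rightarrow> real) \<Rightarrow> real measure) \<Rightarrow> (nat \<Rightarrow> 'x) \<Rightarrow> bool" where
  "nondecreasing_separable n \<pi> xs \<longleftrightarrow>
     (\<exists>P. separable_via n \<pi> xs P \<and> coordinatewise_mono n P)"

definition expected_regret ::
  "real \<Rightarrow> real \<Rightarrow> nat \<Rightarrow> ((nat \<Rightarrow> 'x) \<Rightarrow> (nat \<Rightarrow> real) \<Rightarrow> real measure) \<Rightarrow> (nat \<Rightarrow> 'x) \<Rightarrow>
    real measure \<Rightarrow> (nat \<Rightarrow> real measure) \<Rightarrow> real" where
  "expected_regret c\<^sub>o c\<^sub>u n \<pi> xs F\<^sub>0 F =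
     (\<integral>ys. mixed_regret c\<^sub>o c\<^sub>u (\<pi> xs ys) F\<^sub>0 \<partial>(Pi\<^sub>M {1..n} F))"

text \<open>
  With nonnegative costs summing to one, losses lie in \<open>[0, 1]\<close>, so the expected regrets are
  bounded; with a nonnegative \<open>d\<close>, the inner index set contains the constant family \<open>F\<^sub>0\<close>.
  Hence the suprema are taken over nonempty bounded sets of reals.
\<close>

definition worst_case_regret ::
  "real \<Rightarrow> real \<Rightarrow> ('x \<Rightarrow> 'x \<Rightarrow> real) \<Rightarrow> nat \<Rightarrow>
    ((nat \<Rightarrow> 'x) \<Rightarrow> (nat \<Rightarrow> real) \<Rightarrow> real measure) \<Rightarrow> (nat \<Rightarrow> 'x) \<Rightarrow> real" where
  "worst_case_regret c\<^sub>o c\<^sub>u d n \<pi> xs =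
     (SUP F\<^sub>0 \<in> Delta.
        SUP F \<in> {F \<in> {1..n} \<rightarrow> Delta. \<forall>i\<in>{1..n}. kolmogorov_dist F\<^sub>0 (F i) \<le> d (xs 0) (xs i)}.
          expected_regret c\<^sub>o c\<^sub>u n \<pi> xs F\<^sub>0 F)"

definition bernoulli_dist :: "real \<Rightarrow> real measure" where
  "bernoulli_dist \<mu> = distr (measure_pmf (bernoulli_pmf (min (max \<mu> 0) 1))) unit_borel of_bool"

lemma bernoulli_dist_in_Delta: "bernoulli_dist \<mu> \<in> Delta"
  unfolding Delta_def bernoulli_dist_def space_prob_algebra
  by (auto simp: unit_borel_def space_restrict_space intro!: measure_pmf.prob_space_distr)

end

theory Submission
  imports Defs
begin

text \<open>
  Writing the newsvendor loss as an integral over thresholds \<open>t \<in> [0, 1]\<close> turns the expected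
  regret into \<open>\<integral> (P(F\<^sub>1(t), \<dots>, F\<^sub>n(t)) - 1[q \<le> F\<^sub>0(t)]) (q - F\<^sub>0(t)) dt\<close>, because the law of
  the action has cdf \<open>P(F\<^sub>1, \<dots>, F\<^sub>n)\<close> and the optimal action has cdf \<open>1[q \<le> F\<^sub>0]\<close> almost
  everywhere. At each \<open>t\<close>, monotonicity of \<open>P\<close> and the Kolmogorov constraint bound the integrand
  by its value with every \<open>F\<^sub>i(t)\<close> pushed down to \<open>F\<^sub>0(t) - d\<^sub>i\<close> (if \<open>q \<le> F\<^sub>0(t)\<close>) or up to
  \<open>F\<^sub>0(t) + d\<^sub>i\<close> (otherwise), clipped to the unit interval. Bernoulli cdfs are constant on
  \<open>[0, 1)\<close>, so with \<open>\<mu>\<^sub>0 = 1 - F\<^sub>0(t)\<close> this bound is exactly the regret of a feasible Bernoulli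
  instance.
\<close>

section \<open>The uniform measure on thresholds\<close>

text \<open>The measure in which thresholds are integrated. It has mass one, so bounded measurable
  integrands are integrable and a constant integrates to itself.\<close>

abbreviation uniform_unit :: "real measure" where
  "uniform_unit \<equiv> restrict_space lborel {0..1}"

lemma prob_space_uniform_unit: "prob_space uniform_unit"
  by (rule prob_spaceI) (simp add: space_restrict_space emeasure_restrict_space)

lemma AE_uniform_unit_iff:
  "(AE t in uniform_unit. Q t) \<longleftrightarrow> (AE t in lborel. t \<in> {0..1} \<longrightarrow> Q t)"
  by (rule AE_restrict_space_iff) simp

lemma measurable_uniform_unit_ident [measurable]: "(\<lambda>t. t) \<in> borel_measurable uniform_unit"
  by (rule measurable_restrict_space1) simp

section \<open>Laws on the unit interval and their cdfs\<close>

lemma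
  assumes "F \<in> Delta"
  shows prob_space_Delta: "prob_space F"
    and sets_Delta: "sets F = sets unit_borel"
    and space_Delta: "space F = {0..1}"
    and borel_measurable_Delta_ident: "(\<lambda>a. a) \<in> borel_measurable F"
proof -
  show "prob_space F" and sets: "sets F = sets unit_borel"
    using assms by (simp_all add: Delta_def space_prob_algebra)
  show "space F = {0..1}"
    using sets_eq_imp_space_eq[OF sets] by (simp add: unit_borel_def space_restrict_space)
  show "(\<lambda>a. a) \<in> borel_measurable F"
    unfolding measurable_cong_sets[OF sets refl] unit_borel_def
    by (rule measurable_restrict_space1) simp
qed

lemma cdf_unit_eq_integral:
  assumes "F \<in> Delta"
  shows "cdf_unit F t = (\<integral>a. of_bool (a \<le> t) \<partial>F)"
proof -
  note [measurable] = borel_measurable_Delta_ident[OF assms]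
  have "(\<integral>a. of_bool (a \<le> t) \<partial>F) = (\<integral>a. indicator {a \<in> space F. a \<le> t} a \<partial>F)"
    by (intro Bochner_Integration.integral_cong) (auto simp: indicator_def)
  also have "\<dots> = measure F ({a \<in> space F. a \<le> t} \<inter> space F)"
    by (rule Bochner_Integration.integral_indicator)
  also have "\<dots> = cdf_unit F t"
    unfolding cdf_unit_def by (rule arg_cong[where f = "measure F"]) auto
  finally show ?thesis by simp
qed

lemma cdf_unit_mono:
  assumes "F \<in> Delta" "s \<le> t"
  shows "cdf_unit F s \<le> cdf_unit F t"
proof -
  interpret prob_space F by (rule prob_space_Delta[OF assms(1)])
  note [measurable] = borel_measurable_Delta_ident[OF assms(1)]
  show ?thesis
    unfolding cdf_unit_def using assms(2) by (intro finite_measure_mono) auto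
qed

lemma cdf_unit_bounds:
  assumes "F \<in> Delta"
  shows "0 \<le> cdf_unit F t" "cdf_unit F t \<le> 1"
proof -
  interpret prob_space F by (rule prob_space_Delta[OF assms])
  show "0 \<le> cdf_unit F t" "cdf_unit F t \<le> 1"
    by (simp_all add: cdf_unit_def)
qed

lemma cdf_unit_1:
  assumes "F \<in> Delta"
  shows "cdf_unit F 1 = 1"
proof -
  interpret prob_space F by (rule prob_space_Delta[OF assms])
  have "{a \<in> space F. a \<le> 1} = space F"
    by (auto simp: space_Delta[OF assms])
  then show ?thesis
    by (simp add: cdf_unit_def prob_space)
qed

lemma borel_measurable_cdf_unit:
  assumes "F \<in> Delta"
  shows "cdf_unit F \<in> borel_measurable uniform_unit"
  by (rule measurable_restrict_space1)
    (simp add: borel_measurable_mono mono_def cdf_unit_mono[OF assms])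

section \<open>Losses as integrals over thresholds\<close>

text \<open>Fubini: \<open>a\<close> enters only through \<open>of_bool (a \<le> t)\<close>, whose
  mean is the cdf at \<open>t\<close>; the bounds on \<open>g\<close> and \<open>h\<close> give
  joint integrability. It is applied twice, to average over the outcome and then over the
  action.\<close>

lemma expectation_threshold_integral:
  assumes F: "F \<in> Delta"
    and [measurable]: "g \<in> borel_measurable uniform_unit" "h \<in> borel_measurable uniform_unit"
    and g: "\<And>t. t \<in> {0..1} \<Longrightarrow> \<bar>g t\<bar> \<le> B" and h: "\<And>t. t \<in> {0..1} \<Longrightarrow> \<bar>h t\<bar> \<le> B"
  shows "(\<integral>a. (\<integral>t. g t + h t * of_bool (a \<le> t) \<partial>uniform_unit) \<partial>F)
       = (\<integral>t. g t + h t * cdf_unit F t \<partial>uniform_unit)"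
proof -
  interpret F: prob_space F by (rule prob_space_Delta[OF F])
  interpret U: prob_space uniform_unit by (rule prob_space_uniform_unit)
  interpret FU: pair_prob_space F uniform_unit ..
  note [measurable] = borel_measurable_Delta_ident[OF F]
  have "integrable (F \<Otimes>\<^sub>M uniform_unit) (\<lambda>(a, t). g t + h t * of_bool (a \<le> t))"
  proof (rule FU.integrable_const_bound)
    show "AE p in F \<Otimes>\<^sub>M uniform_unit. norm (case p of (a, t) \<Rightarrow> g t + h t * of_bool (a \<le> t)) \<le> 2 * B"
    proof (rule AE_I2, clarify)
      fix a t assume "(a, t) \<in> space (F \<Otimes>\<^sub>M uniform_unit)"
      then have "t \<in> {0..1}"
        by (auto simp: space_pair_measure space_restrict_space)
      with g[of t] h[of t] show "norm (g t + h t * of_bool (a \<le> t)) \<le> 2 * B"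
        by (auto simp: of_bool_def)
    qed
    show "(\<lambda>(a, t). g t + h t * of_bool (a \<le> t)) \<in> borel_measurable (F \<Otimes>\<^sub>M uniform_unit)"
      unfolding of_bool_def by measurable
  qed
  then have "(\<integral>a. (\<integral>t. g t + h t * of_bool (a \<le> t) \<partial>uniform_unit) \<partial>F)
       = (\<integral>t. (\<integral>a. g t + h t * of_bool (a \<le> t) \<partial>F) \<partial>uniform_unit)"
    by (rule FU.Fubini_integral[symmetric])
  also have "\<dots> = (\<integral>t. g t + h t * cdf_unit F t \<partial>uniform_unit)"
  proof (rule Bochner_Integration.integral_cong[OF refl])
    fix t
    have "integrable F (\<lambda>a. of_bool (a \<le> t) :: real)"
      by (rule F.integrable_const_bound[of _ 1]) (auto simp: of_bool_def)
    then show "(\<integral>a. g t + h t * of_bool (a \<le> t) \<partial>F) = g t + h t * cdf_unit F t"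
      by (simp add: cdf_unit_eq_integral[OF F] F.prob_space)
  qed
  finally show ?thesis .
qed

text \<open>
  The newsvendor loss integrates, over thresholds \<open>t\<close>, the cost \<open>c\<^sub>o\<close> of the event
  \<open>y \<le> t < a\<close> and the cost \<open>c\<^sub>u\<close> of the event \<open>a \<le> t < y\<close>; since \<open>c\<^sub>o + c\<^sub>u = 1\<close> this
  sum is the integrand below.
\<close>

lemma nv_loss_eq_integral:
  assumes c: "c\<^sub>o + c\<^sub>u = 1" and a: "a \<in> {0..1}" and y: "y \<in> {0..1}"
  shows "nv_loss c\<^sub>o c\<^sub>u a y =
    (\<integral>t. c\<^sub>u * of_bool (a \<le> t) + (c\<^sub>o - of_bool (a \<le> t)) * of_bool (y \<le> t) \<partial>uniform_unit)"
proof -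
  have len: "(\<integral>t. indicator {u..<v} t \<partial>uniform_unit) = v - u"
    if "0 \<le> u" "u \<le> v" "v \<le> 1" for u v :: real
  proof -
    have "(\<integral>t. indicator {u..<v} t \<partial>uniform_unit) = measure uniform_unit ({u..<v} \<inter> {0..1})"
      by (simp add: space_restrict_space)
    also have "{u..<v} \<inter> {0..1} = {u..<v}"
      using that by auto
    also have "measure uniform_unit {u..<v} = measure lborel {u..<v}"
      using that by (intro measure_restrict_space) auto
    finally show ?thesis using that by simp
  qed
  \<comment> \<open>With this substitution the integrand cancels for thresholds beyond both
    \<open>a\<close> and \<open>y\<close>, leaving a constant on the half-open interval between
    them.\<close>
  have cu: "c\<^sub>u = 1 - c\<^sub>o" using c by simp
  show ?thesis
  proof (cases "y \<le> a")
    case True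
    have "(\<integral>t. c\<^sub>u * of_bool (a \<le> t) + (c\<^sub>o - of_bool (a \<le> t)) * of_bool (y \<le> t) \<partial>uniform_unit)
        = (\<integral>t. c\<^sub>o * indicator {y..<a} t \<partial>uniform_unit)"
      by (rule Bochner_Integration.integral_cong)
        (use True in \<open>auto simp: cu indicator_def of_bool_def\<close>)
    then show ?thesis
      using True a y by (simp add: len nv_loss_def del: Bochner_Integration.integral_indicator)
  next
    case False
    have "(\<integral>t. c\<^sub>u * of_bool (a \<le> t) + (c\<^sub>o - of_bool (a \<le> t)) * of_bool (y \<le> t) \<partial>uniform_unit)
        = (\<integral>t. c\<^sub>u * indicator {a..<y} t \<partial>uniform_unit)"
      by (rule Bochner_Integration.integral_cong)
        (use False in \<open>auto simp: cu indicator_def of_bool_def\<close>)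
    then show ?thesis
      using False a y by (simp add: len nv_loss_def del: Bochner_Integration.integral_indicator)
  qed
qed

text \<open>The loss is averaged over the outcome and then regrouped as an affine expression in
  \<open>of_bool (a \<le> t)\<close>, the form in which it can next be averaged over the
  action.\<close>

lemma action_loss_eq_integral:
  assumes F: "F \<in> Delta" and c: "c\<^sub>o + c\<^sub>u = 1" and a: "a \<in> {0..1}"
  shows "action_loss c\<^sub>o c\<^sub>u a F =
    (\<integral>t. c\<^sub>o * cdf_unit F t + (c\<^sub>u - cdf_unit F t) * of_bool (a \<le> t) \<partial>uniform_unit)"
proof -
  have "action_loss c\<^sub>o c\<^sub>u a F = (\<integral>y. (\<integral>t. c\<^sub>u * of_bool (a \<le> t) +
      (c\<^sub>o - of_bool (a \<le> t)) * of_bool (y \<le> t) \<partial>uniform_unit) \<partial>F)"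
    unfolding action_loss_def
    by (rule Bochner_Integration.integral_cong)
      (simp_all add: nv_loss_eq_integral[OF c a] space_Delta[OF F])
  also have "\<dots> = (\<integral>t. c\<^sub>u * of_bool (a \<le> t) +
      (c\<^sub>o - of_bool (a \<le> t)) * cdf_unit F t \<partial>uniform_unit)"
  proof (rule expectation_threshold_integral[OF F, where B = "\<bar>c\<^sub>o\<bar> + \<bar>c\<^sub>u\<bar> + 1"])
    show "(\<lambda>t. c\<^sub>u * of_bool (a \<le> t)) \<in> borel_measurable uniform_unit"
      "(\<lambda>t. c\<^sub>o - of_bool (a \<le> t)) \<in> borel_measurable uniform_unit"
      unfolding of_bool_def by measurable
  qed (auto simp: of_bool_def)
  also have "\<dots> = (\<integral>t. c\<^sub>o * cdf_unit F t + (c\<^sub>u - cdf_unit F t) * of_bool (a \<le> t) \<partial>uniform_unit)"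
    by (simp add: algebra_simps)
  finally show ?thesis .
qed

text \<open>The second use of Fubini, now over the action: the loss depends on \<open>N\<close> only
  through its cdf, and affinely.\<close>

lemma mixed_loss_eq_integral:
  assumes N: "N \<in> Delta" and F: "F \<in> Delta" and c: "c\<^sub>o + c\<^sub>u = 1"
  shows "mixed_loss c\<^sub>o c\<^sub>u N F =
    (\<integral>t. c\<^sub>o * cdf_unit F t + (c\<^sub>u - cdf_unit F t) * cdf_unit N t \<partial>uniform_unit)"
proof -
  note [measurable] = borel_measurable_cdf_unit[OF F]
  have "mixed_loss c\<^sub>o c\<^sub>u N F = (\<integral>a. (\<integral>t. c\<^sub>o * cdf_unit F t +
      (c\<^sub>u - cdf_unit F t) * of_bool (a \<le> t) \<partial>uniform_unit) \<partial>N)"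
    unfolding mixed_loss_def
    by (rule Bochner_Integration.integral_cong)
      (simp_all add: action_loss_eq_integral[OF F c] space_Delta[OF N])
  also have "\<dots> = (\<integral>t. c\<^sub>o * cdf_unit F t + (c\<^sub>u - cdf_unit F t) * cdf_unit N t \<partial>uniform_unit)"
  proof (rule expectation_threshold_integral[OF N, where B = "\<bar>c\<^sub>o\<bar> + \<bar>c\<^sub>u\<bar> + 1"])
    fix t :: real
    have "\<bar>c\<^sub>o * cdf_unit F t\<bar> \<le> \<bar>c\<^sub>o\<bar>"
      using cdf_unit_bounds[OF F, of t] by (auto simp: abs_mult intro: mult_left_le)
    then show "\<bar>c\<^sub>o * cdf_unit F t\<bar> \<le> \<bar>c\<^sub>o\<bar> + \<bar>c\<^sub>u\<bar> + 1" by simp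
    show "\<bar>c\<^sub>u - cdf_unit F t\<bar> \<le> \<bar>c\<^sub>o\<bar> + \<bar>c\<^sub>u\<bar> + 1"
      using cdf_unit_bounds[OF F, of t] by simp
  qed simp_all
  finally show ?thesis .
qed

section \<open>The optimal action and the regret as a threshold integral\<close>

text \<open>The infimum is over a nonempty set: 1 belongs to it, because every cdf here equals 1 at
  1.\<close>

lemma opt_action_in_unit:
  assumes F: "F \<in> Delta" and "critical_ratio c\<^sub>o c\<^sub>u \<le> 1"
  shows "opt_action c\<^sub>o c\<^sub>u F \<in> {0..1}"
proof -
  have 1: "1 \<in> {a \<in> {0..1}. cdf_unit F a \<ge> critical_ratio c\<^sub>o c\<^sub>u}"
    using assms by (simp add: cdf_unit_1)
  then have "opt_action c\<^sub>o c\<^sub>u F \<ge> 0"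
    unfolding opt_action_def by (intro cInf_greatest) auto
  moreover have "opt_action c\<^sub>o c\<^sub>u F \<le> 1"
    unfolding opt_action_def by (rule cInf_lower[OF 1]) (auto intro!: bdd_belowI[of _ 0])
  ultimately show ?thesis by simp
qed

text \<open>The usual duality between quantile and cdf. The point
  \<open>t = opt_action c\<^sub>o c\<^sub>u F\<close> is excluded since there the forward direction
  would rest on right-continuity; for \<open>t\<close> strictly above the infimum, a smaller member
  of the set and monotonicity suffice. One point is negligible in the threshold integral.\<close>

lemma opt_action_le_iff:
  assumes F: "F \<in> Delta" and q: "critical_ratio c\<^sub>o c\<^sub>u \<le> 1"
    and t: "t \<in> {0..1}" "t \<noteq> opt_action c\<^sub>o c\<^sub>u F"
  shows "opt_action c\<^sub>o c\<^sub>u F \<le> t \<longleftrightarrow> critical_ratio c\<^sub>o c\<^sub>u \<le> cdf_unit F t"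
proof -
  define A where "A = {a \<in> {0..1}. cdf_unit F a \<ge> critical_ratio c\<^sub>o c\<^sub>u}"
  have A: "1 \<in> A" "bdd_below A"
    using F q by (auto simp: A_def cdf_unit_1 intro!: bdd_belowI[of _ 0])
  have opt: "opt_action c\<^sub>o c\<^sub>u F = Inf A"
    by (simp add: opt_action_def A_def)
  show ?thesis
  proof
    assume "opt_action c\<^sub>o c\<^sub>u F \<le> t"
    with t have "Inf A < t" by (simp add: opt)
    then obtain a where "a \<in> A" "a < t"
      using cInf_less_iff[of A t] A by auto
    then show "critical_ratio c\<^sub>o c\<^sub>u \<le> cdf_unit F t"
      using cdf_unit_mono[OF F, of a t] by (auto simp: A_def)
  next
    assume "critical_ratio c\<^sub>o c\<^sub>u \<le> cdf_unit F t"
    with t have "t \<in> A" by (simp add: A_def)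
    then show "opt_action c\<^sub>o c\<^sub>u F \<le> t"
      unfolding opt using A by (intro cInf_lower)
  qed
qed

text \<open>
  The integrand of the regret at a threshold where the action has cdf value \<open>p\<close> and the outcome
  has cdf value \<open>f\<close>.
\<close>

definition regret_density :: "real \<Rightarrow> real \<Rightarrow> real \<Rightarrow> real" where
  "regret_density q p f = (p - of_bool (q \<le> f)) * (q - f)"

lemma borel_measurable_regret_density:
  assumes "N \<in> Delta" "F \<in> Delta"
  shows "(\<lambda>t. regret_density q (cdf_unit N t) (cdf_unit F t)) \<in> borel_measurable uniform_unit"
proof -
  note [measurable] = borel_measurable_cdf_unit[OF assms(1)] borel_measurable_cdf_unit[OF assms(2)]
  show ?thesis
    unfolding regret_density_def of_bool_def by measurable
qed

text \<open>Both losses in the regret have the same threshold form and differ only in the cdf of the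
  action, so their difference factors into the density.\<close>

lemma mixed_regret_eq_integral:
  assumes N: "N \<in> Delta" and F: "F \<in> Delta" and c: "c\<^sub>o \<ge> 0" "c\<^sub>o + c\<^sub>u = 1"
  shows "mixed_regret c\<^sub>o c\<^sub>u N F =
    (\<integral>t. regret_density c\<^sub>u (cdf_unit N t) (cdf_unit F t) \<partial>uniform_unit)"
proof -
  interpret U: prob_space uniform_unit by (rule prob_space_uniform_unit)
  note [measurable] = borel_measurable_cdf_unit[OF F] borel_measurable_cdf_unit[OF N]
  have q: "critical_ratio c\<^sub>o c\<^sub>u = c\<^sub>u" "critical_ratio c\<^sub>o c\<^sub>u \<le> 1"
    using c by (auto simp: critical_ratio_def add.commute)
  define a where "a = opt_action c\<^sub>o c\<^sub>u F"
  have a: "a \<in> {0..1}"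
    unfolding a_def by (rule opt_action_in_unit[OF F q(2)])
  \<comment> \<open>Stated for general \<open>p\<close> to cover both the cdf of \<open>N\<close>
    and the indicator of \<open>a \<le> t\<close>.\<close>
  have int: "integrable uniform_unit (\<lambda>t. c\<^sub>o * cdf_unit F t + (c\<^sub>u - cdf_unit F t) * p t)"
    if [measurable]: "p \<in> borel_measurable uniform_unit" and "\<And>t. 0 \<le> p t" "\<And>t. p t \<le> 1" for p
  proof (rule U.integrable_const_bound[of _ "\<bar>c\<^sub>o\<bar> + (\<bar>c\<^sub>u\<bar> + 1)"])
    have "norm (c\<^sub>o * cdf_unit F t + (c\<^sub>u - cdf_unit F t) * p t) \<le> \<bar>c\<^sub>o\<bar> + (\<bar>c\<^sub>u\<bar> + 1)" for t
    proof -
      have "\<bar>c\<^sub>o * cdf_unit F t\<bar> \<le> \<bar>c\<^sub>o\<bar>"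
        using cdf_unit_bounds[OF F, of t] by (auto simp: abs_mult intro: mult_left_le)
      moreover have "\<bar>(c\<^sub>u - cdf_unit F t) * p t\<bar> \<le> \<bar>c\<^sub>u - cdf_unit F t\<bar>"
        using that(2,3)[of t] by (auto simp: abs_mult intro: mult_left_le)
      ultimately show ?thesis
        using cdf_unit_bounds[OF F, of t] by simp
    qed
    then show "AE t in uniform_unit.
      norm (c\<^sub>o * cdf_unit F t + (c\<^sub>u - cdf_unit F t) * p t) \<le> \<bar>c\<^sub>o\<bar> + (\<bar>c\<^sub>u\<bar> + 1)"
      by simp
  qed measurable
  have meas_a: "(\<lambda>t. of_bool (a \<le> t) :: real) \<in> borel_measurable uniform_unit"
    unfolding of_bool_def by measurable
  have "mixed_regret c\<^sub>o c\<^sub>u N F =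
    (\<integral>t. (c\<^sub>o * cdf_unit F t + (c\<^sub>u - cdf_unit F t) * cdf_unit N t) -
      (c\<^sub>o * cdf_unit F t + (c\<^sub>u - cdf_unit F t) * of_bool (a \<le> t)) \<partial>uniform_unit)"
    unfolding mixed_regret_def a_def[symmetric] mixed_loss_eq_integral[OF N F c(2)]
      action_loss_eq_integral[OF F c(2) a]
    by (intro Bochner_Integration.integral_diff[symmetric] int meas_a)
      (auto simp: cdf_unit_bounds[OF N])
  also have "\<dots> = (\<integral>t. regret_density c\<^sub>u (cdf_unit N t) (cdf_unit F t) \<partial>uniform_unit)"
  proof (rule integral_cong_AE)
    \<comment> \<open>Off the null set \<open>{a}\<close>, the indicator of \<open>a \<le> t\<close>
      is that of \<open>c\<^sub>u \<le> cdf_unit F t\<close>.\<close>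
    show "AE t in uniform_unit. (c\<^sub>o * cdf_unit F t + (c\<^sub>u - cdf_unit F t) * cdf_unit N t) -
      (c\<^sub>o * cdf_unit F t + (c\<^sub>u - cdf_unit F t) * of_bool (a \<le> t)) =
      regret_density c\<^sub>u (cdf_unit N t) (cdf_unit F t)"
      unfolding AE_uniform_unit_iff
      using AE_lborel_singleton[of a]
    proof eventually_elim
      case (elim t)
      then show ?case
        using opt_action_le_iff[OF F q(2), of t]
        by (auto simp: a_def q(1) regret_density_def algebra_simps)
    qed
  qed (use meas_a borel_measurable_regret_density[OF N F] in simp_all)
  finally show ?thesis .
qed

section \<open>Averaging the regret over the samples\<close>

text \<open>The regret is the integral of a bounded function of the action minus a constant, so
  averaging it over samples amounts to integrating against the law of the action, which is the
  bind.\<close>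

lemma
  assumes pol: "is_policy n \<pi>" and xs: "xs \<in> contexts n"
    and F: "F \<in> {1..n} \<rightarrow> Delta"
  shows action_law_in_Delta: "Pi\<^sub>M {1..n} F \<bind> \<pi> xs \<in> Delta"
    and expected_regret_eq_mixed_regret: "F\<^sub>0 \<in> Delta \<Longrightarrow> c\<^sub>o + c\<^sub>u = 1 \<Longrightarrow>
      expected_regret c\<^sub>o c\<^sub>u n \<pi> xs F\<^sub>0 F = mixed_regret c\<^sub>o c\<^sub>u (Pi\<^sub>M {1..n} F \<bind> \<pi> xs) F\<^sub>0"
proof -
  let ?M = "Pi\<^sub>M {1..n} F"
  have F': "F i \<in> Delta" if "i \<in> {1..n}" for i
    using F that by auto
  interpret M: prob_space ?M
    by (intro prob_space_PiM prob_space_Delta F')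
  have sets: "sets ?M = sets (Pi\<^sub>M {1..n} (\<lambda>_. unit_borel))"
    by (intro sets_PiM_cong refl sets_Delta F')
  have kernel: "\<pi> xs \<in> ?M \<rightarrow>\<^sub>M prob_algebra unit_borel"
    unfolding measurable_cong_sets[OF sets refl] using pol xs unfolding is_policy_def by blast
  have kernel': "\<pi> xs \<in> ?M \<rightarrow>\<^sub>M subprob_algebra unit_borel"
    by (rule measurable_prob_algebraD[OF kernel])
  have \<pi>: "\<pi> xs ys \<in> Delta" if "ys \<in> space ?M" for ys
    using measurable_space[OF kernel that] by (simp add: Delta_def)
  have M: "?M \<in> space (prob_algebra ?M)"
    using M.prob_space_axioms by (simp add: space_prob_algebra)
  show "?M \<bind> \<pi> xs \<in> Delta"
    using prob_space_bind'[OF M kernel] sets_bind'[OF M kernel]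
    by (simp add: Delta_def space_prob_algebra)
  assume F0: "F\<^sub>0 \<in> Delta" and c: "c\<^sub>o + c\<^sub>u = 1"
  interpret U: prob_space uniform_unit by (rule prob_space_uniform_unit)
  note [measurable] = borel_measurable_cdf_unit[OF F0]
  \<comment> \<open>On the unit interval \<open>f\<close> is the action loss; written as a parameter
    integral, it is visibly measurable in \<open>a\<close>.\<close>
  define f where "f a = (\<integral>t. c\<^sub>o * cdf_unit F\<^sub>0 t + (c\<^sub>u - cdf_unit F\<^sub>0 t) * of_bool (a \<le> t) \<partial>uniform_unit)" for a
  have f_eq: "f a = action_loss c\<^sub>o c\<^sub>u a F\<^sub>0" if "a \<in> {0..1}" for a
    by (simp add: f_def action_loss_eq_integral[OF F0 c that])
  have loss: "mixed_loss c\<^sub>o c\<^sub>u N F\<^sub>0 = integral\<^sup>L N f" if "N \<in> Delta" for N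
    unfolding mixed_loss_def
    by (rule Bochner_Integration.integral_cong) (simp_all add: f_eq space_Delta[OF that])
  have f_meas: "f \<in> borel_measurable unit_borel"
  proof -
    have [measurable]: "(\<lambda>a. a) \<in> borel_measurable unit_borel"
      unfolding unit_borel_def by (rule measurable_restrict_space1) simp
    show ?thesis
      unfolding f_def of_bool_def by measurable
  qed
  have f_bound: "\<bar>f a\<bar> \<le> \<bar>c\<^sub>o\<bar> + \<bar>c\<^sub>u\<bar>" if "a \<in> space unit_borel" for a
  proof -
    have a: "a \<in> {0..1}"
      using that by (simp add: unit_borel_def space_restrict_space)
    interpret F0: prob_space F\<^sub>0 by (rule prob_space_Delta[OF F0])
    note [measurable] = borel_measurable_Delta_ident[OF F0]
    have nv_meas: "nv_loss c\<^sub>o c\<^sub>u a \<in> borel_measurable F\<^sub>0"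
      unfolding nv_loss_def[abs_def] by measurable
    have b: "\<bar>nv_loss c\<^sub>o c\<^sub>u a y\<bar> \<le> \<bar>c\<^sub>o\<bar> + \<bar>c\<^sub>u\<bar>" if "y \<in> {0..1}" for y
    proof -
      have "\<bar>c\<^sub>o * max 0 (a - y)\<bar> \<le> \<bar>c\<^sub>o\<bar>" "\<bar>c\<^sub>u * max 0 (y - a)\<bar> \<le> \<bar>c\<^sub>u\<bar>"
        using a that by (auto simp: abs_mult intro!: mult_left_le)
      then show ?thesis
        unfolding nv_loss_def by (intro order_trans[OF abs_triangle_ineq] add_mono)
    qed
    have "\<bar>f a\<bar> = \<bar>\<integral>y. nv_loss c\<^sub>o c\<^sub>u a y \<partial>F\<^sub>0\<bar>"
      by (simp add: f_eq[OF a] action_loss_def)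
    also have "\<dots> \<le> (\<integral>y. \<bar>nv_loss c\<^sub>o c\<^sub>u a y\<bar> \<partial>F\<^sub>0)"
      by (rule integral_abs_bound)
    also have "\<dots> \<le> \<bar>c\<^sub>o\<bar> + \<bar>c\<^sub>u\<bar>"
      by (rule F0.integral_le_const, rule F0.integrable_const_bound[of _ "\<bar>c\<^sub>o\<bar> + \<bar>c\<^sub>u\<bar>"])
        (use nv_meas in \<open>auto intro!: AE_I2 b simp: space_Delta[OF F0]\<close>)
    finally show ?thesis .
  qed
  \<comment> \<open>The exchange needs a bounded integrand and kernels of mass at most
    \<open>B' = 1\<close>.\<close>
  have bind: "integral\<^sup>L (?M \<bind> \<pi> xs) f = (\<integral>ys. integral\<^sup>L (\<pi> xs ys) f \<partial>?M)"
  proof (rule integral_bind[where K = unit_borel and B = "\<bar>c\<^sub>o\<bar> + \<bar>c\<^sub>u\<bar>" and B' = 1])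
    show "AE ys in ?M. emeasure (\<pi> xs ys) (space (\<pi> xs ys)) \<le> ennreal 1"
      using \<pi> by (intro AE_I2) (simp add: prob_space.emeasure_space_1[OF prob_space_Delta])
  qed (use f_meas f_bound kernel' M.finite_measure_axioms in auto)
  have int: "integrable ?M (\<lambda>ys. integral\<^sup>L (\<pi> xs ys) f)"
  proof (rule M.integrable_const_bound)
    show "(\<lambda>ys. integral\<^sup>L (\<pi> xs ys) f) \<in> borel_measurable ?M"
      by (rule measurable_compose[OF kernel' integral_measurable_subprob_algebra[OF f_meas]])
    show "AE ys in ?M. norm (integral\<^sup>L (\<pi> xs ys) f) \<le> \<bar>c\<^sub>o\<bar> + \<bar>c\<^sub>u\<bar>"
    proof (rule AE_I2)
      fix ys assume "ys \<in> space ?M"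
      from \<pi>[OF this] have P: "\<pi> xs ys \<in> Delta" .
      interpret P: prob_space "\<pi> xs ys" by (rule prob_space_Delta[OF P])
      have [measurable]: "f \<in> borel_measurable (\<pi> xs ys)"
        using f_meas by (simp add: measurable_cong_sets[OF sets_Delta[OF P] refl])
      have sp: "space (\<pi> xs ys) = space unit_borel"
        by (rule sets_eq_imp_space_eq[OF sets_Delta[OF P]])
      have "norm (integral\<^sup>L (\<pi> xs ys) f) \<le> (\<integral>a. norm (f a) \<partial>\<pi> xs ys)"
        by (rule integral_norm_bound)
      also have "\<dots> \<le> \<bar>c\<^sub>o\<bar> + \<bar>c\<^sub>u\<bar>"
        by (rule P.integral_le_const, rule P.integrable_const_bound[of _ "\<bar>c\<^sub>o\<bar> + \<bar>c\<^sub>u\<bar>"])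
          (auto intro!: AE_I2 f_bound simp: sp)
      finally show "norm (integral\<^sup>L (\<pi> xs ys) f) \<le> \<bar>c\<^sub>o\<bar> + \<bar>c\<^sub>u\<bar>" .
    qed
  qed
  let ?opt = "action_loss c\<^sub>o c\<^sub>u (opt_action c\<^sub>o c\<^sub>u F\<^sub>0) F\<^sub>0"
  have "expected_regret c\<^sub>o c\<^sub>u n \<pi> xs F\<^sub>0 F = (\<integral>ys. integral\<^sup>L (\<pi> xs ys) f - ?opt \<partial>?M)"
    unfolding expected_regret_def mixed_regret_def
    by (rule Bochner_Integration.integral_cong) (simp_all add: loss \<pi>)
  also have "\<dots> = integral\<^sup>L (?M \<bind> \<pi> xs) f - ?opt"
    using int by (simp add: bind M.prob_space del: One_nat_def)
  also have "\<dots> = mixed_regret c\<^sub>o c\<^sub>u (?M \<bind> \<pi> xs) F\<^sub>0"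
    by (simp add: mixed_regret_def loss[OF \<open>?M \<bind> \<pi> xs \<in> Delta\<close>] del: One_nat_def)
  finally show "expected_regret c\<^sub>o c\<^sub>u n \<pi> xs F\<^sub>0 F = mixed_regret c\<^sub>o c\<^sub>u (?M \<bind> \<pi> xs) F\<^sub>0" .
qed


section \<open>Pointwise bounds and monotonicity\<close>

lemma regret_density_bounds:
  assumes "p \<in> {0..1}" "f \<in> {0..1}" "q \<in> {0..1}"
  shows "\<bar>regret_density q p f\<bar> \<le> 1"
proof -
  have "\<bar>p - of_bool (q \<le> f)\<bar> * \<bar>q - f\<bar> \<le> 1 * 1"
    using assms by (intro mult_mono) (auto simp: of_bool_def)
  then show ?thesis
    by (simp add: regret_density_def abs_mult)
qed

text \<open>The density is affine in \<open>p\<close> with slope \<open>q - f\<close>, so the sign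
  of \<open>q - f\<close> decides whether the worst case raises or lowers the cdf of the
  action.\<close>

lemma regret_density_mono:
  assumes "f \<le> q" "p \<le> p'"
  shows "regret_density q p f \<le> regret_density q p' f"
  unfolding regret_density_def using assms by (intro mult_right_mono) auto

lemma regret_density_antimono:
  assumes "q \<le> f" "p' \<le> p"
  shows "regret_density q p f \<le> regret_density q p' f"
  unfolding regret_density_def using assms by (intro mult_right_mono_neg) auto

text \<open>Thresholds have total mass one, so the worst case may be sought separately at each
  threshold.\<close>

lemma mixed_regret_le:
  assumes N: "N \<in> Delta" and F: "F \<in> Delta" and c: "c\<^sub>o \<ge> 0" "c\<^sub>u \<ge> 0" "c\<^sub>o + c\<^sub>u = 1"
    and le: "\<And>t. regret_density c\<^sub>u (cdf_unit N t) (cdf_unit F t) \<le> B"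
  shows "mixed_regret c\<^sub>o c\<^sub>u N F \<le> B"
proof -
  interpret U: prob_space uniform_unit by (rule prob_space_uniform_unit)
  have "integrable uniform_unit (\<lambda>t. regret_density c\<^sub>u (cdf_unit N t) (cdf_unit F t))"
    using c cdf_unit_bounds[OF N] cdf_unit_bounds[OF F]
    by (intro U.integrable_const_bound[of _ 1] AE_I2) (simp_all add: regret_density_bounds borel_measurable_regret_density[OF N F])
  then show ?thesis
    unfolding mixed_regret_eq_integral[OF N F c(1,3)] using le
    by (intro U.integral_le_const) simp_all
qed

text \<open>Passes from single coordinates to the product order by replacing the entries of
  \<open>r\<close> with those of \<open>s\<close> one at a time.\<close>

lemma coordinatewise_mono_le:
  assumes P: "coordinatewise_mono n P"
    and r: "r \<in> {1..n} \<rightarrow>\<^sub>E {0..1}" and s: "s \<in> {1..n} \<rightarrow>\<^sub>E {0..1}"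
    and le: "\<And>i. i \<in> {1..n} \<Longrightarrow> r i \<le> s i"
  shows "P r \<le> P s"
proof -
  \<comment> \<open>The hybrid vector takes its entries from \<open>s\<close> on \<open>A\<close>
    and from \<open>r\<close> elsewhere; the induction enlarges \<open>A\<close>.\<close>
  have "P r \<le> P (override_on r s A)" if "A \<subseteq> {1..n}" for A
    using finite_subset[OF that finite_atLeastAtMost] that
  proof (induction A)
    case (insert i A)
    define u where "u = override_on r s A"
    have u: "u \<in> {1..n} \<rightarrow>\<^sub>E {0..1}"
      using r s by (auto simp: u_def override_on_def PiE_iff extensional_def)
    have i: "i \<in> {1..n}" and ui: "u i = r i"
      using insert by (auto simp: u_def)
    have "P (u(i := r i)) \<le> P (u(i := s i))"
      using P u i r s le[OF i] unfolding coordinatewise_mono_def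
      by (auto dest!: bspec[where x = u] bspec[where x = i] simp: PiE_iff mono_on_def)
    also have "u(i := r i) = u"
      by (simp add: ui[symmetric])
    also have "u(i := s i) = override_on r s (insert i A)"
      by (auto simp: u_def override_on_def)
    finally show ?case
      using insert by (simp add: u_def)
  qed simp
  from this[of "{1..n}"] have "P r \<le> P (override_on r s {1..n})" by simp
  also have "override_on r s {1..n} = s"
    using r s by (auto simp: override_on_def PiE_iff extensional_def fun_eq_iff)
  finally show ?thesis .
qed

section \<open>Bernoulli distributions and the Kolmogorov distance\<close>

lemma cdf_unit_bernoulli_dist:
  assumes "0 \<le> t"
  shows "cdf_unit (bernoulli_dist \<mu>) t = (if t < 1 then 1 - min (max \<mu> 0) 1 else 1)"
proof -
  let ?B = "measure_pmf (bernoulli_pmf (min (max \<mu> 0) 1))"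
  have sp: "space (bernoulli_dist \<mu>) = {0..1}"
    by (rule space_Delta[OF bernoulli_dist_in_Delta])
  have "{a \<in> {0..1}. a \<le> t} \<in> sets unit_borel"
    unfolding unit_borel_def sets_restrict_space by (rule image_eqI[of _ _ "{..t}"]) auto
  then have "cdf_unit (bernoulli_dist \<mu>) t = measure ?B {b. of_bool b \<le> t}"
    unfolding cdf_unit_def sp unfolding bernoulli_dist_def
    by (subst measure_distr)
      (auto simp: unit_borel_def space_restrict_space vimage_def)
  also have "{b. of_bool b \<le> t} = (if t < 1 then {False} else UNIV)"
    using assms by (auto simp: of_bool_def UNIV_bool)
  finally show ?thesis
    by (simp add: measure_pmf_single)
qed

text \<open>Clipping to the unit interval is 1-Lipschitz. Means outside the interval are allowed, so
  a mean shifted by a dissimilarity can be used as it stands.\<close>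

lemma kolmogorov_dist_bernoulli_dist_le:
  "kolmogorov_dist (bernoulli_dist \<mu>) (bernoulli_dist \<nu>) \<le> \<bar>\<mu> - \<nu>\<bar>"
  unfolding kolmogorov_dist_def
proof (rule cSUP_least)
  fix t :: real
  show "\<bar>cdf_unit (bernoulli_dist \<mu>) t - cdf_unit (bernoulli_dist \<nu>) t\<bar> \<le> \<bar>\<mu> - \<nu>\<bar>"
  proof (cases "0 \<le> t")
    case False
    then have "{a \<in> {0..1}. a \<le> t} = {}" by auto
    then have "cdf_unit (bernoulli_dist \<rho>) t = 0" for \<rho>
      by (simp only: cdf_unit_def space_Delta[OF bernoulli_dist_in_Delta] measure_empty)
    then show ?thesis by simp
  qed (auto simp: cdf_unit_bernoulli_dist min_def max_def)
qed simp

lemma abs_cdf_unit_diff_le_kolmogorov_dist: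
  assumes "F \<in> Delta" "G \<in> Delta"
  shows "\<bar>cdf_unit F t - cdf_unit G t\<bar> \<le> kolmogorov_dist F G"
  unfolding kolmogorov_dist_def
proof (rule cSUP_upper)
  show "bdd_above (range (\<lambda>y. \<bar>cdf_unit F y - cdf_unit G y\<bar>))"
  proof (rule bdd_aboveI)
    fix x assume "x \<in> range (\<lambda>y. \<bar>cdf_unit F y - cdf_unit G y\<bar>)"
    then obtain y where "x = \<bar>cdf_unit F y - cdf_unit G y\<bar>" by blast
    then show "x \<le> 1"
      using cdf_unit_bounds[OF assms(1), of y] cdf_unit_bounds[OF assms(2), of y] by simp
  qed
qed simp

text \<open>All the cdfs involved are constant on \<open>[0, 1)\<close>, so the threshold integrand
  is a constant there and equals the regret.\<close>

lemma expected_regret_bernoulli_dist: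
  assumes "is_policy n \<pi>" "xs \<in> contexts n" and P: "separable_via n \<pi> xs P"
    and c: "c\<^sub>o \<ge> 0" "c\<^sub>o + c\<^sub>u = 1"
  shows "expected_regret c\<^sub>o c\<^sub>u n \<pi> xs (bernoulli_dist \<mu>\<^sub>0) (\<lambda>i. bernoulli_dist (\<mu> i)) =
    regret_density c\<^sub>u (P (\<lambda>i\<in>{1..n}. 1 - min (max (\<mu> i) 0) 1)) (1 - min (max \<mu>\<^sub>0 0) 1)"
    (is "_ = ?rhs")
proof -
  interpret U: prob_space uniform_unit by (rule prob_space_uniform_unit)
  let ?F = "\<lambda>i. bernoulli_dist (\<mu> i)" and ?G = "bernoulli_dist \<mu>\<^sub>0"
  let ?N = "Pi\<^sub>M {1..n} ?F \<bind> \<pi> xs"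
  have F: "?F \<in> {1..n} \<rightarrow> Delta" by (simp add: bernoulli_dist_in_Delta)
  have N: "?N \<in> Delta" by (rule action_law_in_Delta[OF assms(1,2) F])
  have cdf: "cdf_unit ?N t = P (\<lambda>i\<in>{1..n}. cdf_unit (?F i) t)" for t
    unfolding cdf_unit_def[of ?N] using P F by (auto simp: separable_via_def)
  have "expected_regret c\<^sub>o c\<^sub>u n \<pi> xs ?G ?F =
      (\<integral>t. regret_density c\<^sub>u (cdf_unit ?N t) (cdf_unit ?G t) \<partial>uniform_unit)"
    using expected_regret_eq_mixed_regret[OF assms(1,2) F bernoulli_dist_in_Delta c(2)]
      mixed_regret_eq_integral[OF N bernoulli_dist_in_Delta c] by simp
  also have "\<dots> = (\<integral>t. ?rhs \<partial>uniform_unit)"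
  proof (rule integral_cong_AE)
    \<comment> \<open>The exceptional threshold is \<open>t = 1\<close>, where every cdf jumps to
      1.\<close>
    show "AE t in uniform_unit. regret_density c\<^sub>u (cdf_unit ?N t) (cdf_unit ?G t) = ?rhs"
      unfolding AE_uniform_unit_iff
      using AE_lborel_singleton[of 1]
      by eventually_elim (auto simp: cdf cdf_unit_bernoulli_dist simp del: One_nat_def cong: restrict_cong)
  qed (use borel_measurable_regret_density[OF N bernoulli_dist_in_Delta] in simp_all)
  finally show ?thesis
    using U.prob_space by (simp add: space_restrict_space del: One_nat_def)
qed

section \<open>Reduction of the worst case to Bernoulli instances\<close>

theorem theorem1:
  fixes c\<^sub>o c\<^sub>u q :: real
    and d :: "'x \<Rightarrow> 'x \<Rightarrow> real"
    and n :: nat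
    and xs :: "nat \<Rightarrow> 'x"
    and \<pi> :: "(nat \<Rightarrow> 'x) \<Rightarrow> (nat \<Rightarrow> real) \<Rightarrow> real measure"
  assumes "c\<^sub>o > 0" and "c\<^sub>u > 0" and "c\<^sub>o + c\<^sub>u = 1"
    and "q = critical_ratio c\<^sub>o c\<^sub>u"
    and "\<And>x x'. d x x' \<ge> 0"
    and "n \<ge> 1"
    and "xs \<in> contexts n"
    and "is_policy n \<pi>"
    and "nondecreasing_separable n \<pi> xs"
  shows "worst_case_regret c\<^sub>o c\<^sub>u d n \<pi> xs =
    max
      (SUP \<mu>\<^sub>0 \<in> {0..1 - q}.
         expected_regret c\<^sub>o c\<^sub>u n \<pi> xs (bernoulli_dist \<mu>\<^sub>0)
           (\<lambda>i. bernoulli_dist (\<mu>\<^sub>0 + d (xs 0) (xs i))))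
      (SUP \<mu>\<^sub>0 \<in> {1 - q..1}.
         expected_regret c\<^sub>o c\<^sub>u n \<pi> xs (bernoulli_dist \<mu>\<^sub>0)
           (\<lambda>i. bernoulli_dist (\<mu>\<^sub>0 - d (xs 0) (xs i))))"
proof -
  note c = assms(1-3) and pol = assms(8) and xs = assms(7)
  have q: "q = c\<^sub>u" "0 \<le> q" "q \<le> 1"
    using c assms(4) by (simp_all add: critical_ratio_def add.commute)
  obtain P where P: "separable_via n \<pi> xs P" and mono: "coordinatewise_mono n P"
    using assms(9) by (auto simp: nondecreasing_separable_def)
  have P01: "P p \<in> {0..1}" if "p \<in> {1..n} \<rightarrow>\<^sub>E {0..1}" for p
    using P that by (auto simp: separable_via_def)
  let ?d = "\<lambda>i. d (xs 0) (xs i)"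
  let ?ER = "expected_regret c\<^sub>o c\<^sub>u n \<pi> xs"
  let ?clip = "\<lambda>x::real. min (max x 0) 1"
  define feasible where
    "feasible F\<^sub>0 = {F \<in> {1..n} \<rightarrow> Delta. \<forall>i\<in>{1..n}. kolmogorov_dist F\<^sub>0 (F i) \<le> ?d i}" for F\<^sub>0
  \<comment> \<open>Raising the means of the samples lowers their cdfs on \<open>[0, 1)\<close>;
    \<open>down\<close> does the reverse.\<close>
  define up where "up \<mu> = ?ER (bernoulli_dist \<mu>) (\<lambda>i. bernoulli_dist (\<mu> + ?d i))" for \<mu>
  define down where "down \<mu> = ?ER (bernoulli_dist \<mu>) (\<lambda>i. bernoulli_dist (\<mu> - ?d i))" for \<mu>
  let ?M = "max (SUP \<mu>\<in>{0..1 - q}. up \<mu>) (SUP \<mu>\<in>{1 - q..1}. down \<mu>)"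

  note bernoulli = expected_regret_bernoulli_dist[OF pol xs P less_imp_le[OF c(1)] c(3)]
  \<comment> \<open>This bound makes both families bounded above, so that each member lies below its
    supremum.\<close>
  have ER_le_1: "?ER (bernoulli_dist \<mu>) (\<lambda>i. bernoulli_dist (\<nu> i)) \<le> 1" for \<mu> \<nu>
  proof -
    have "P (\<lambda>i\<in>{1..n}. 1 - ?clip (\<nu> i)) \<in> {0..1}"
      by (rule P01) auto
    then show ?thesis
      unfolding bernoulli using q by (intro abs_le_D1[OF regret_density_bounds]) auto
  qed
  have up_le: "up \<mu> \<le> ?M" if "\<mu> \<in> {0..1 - q}" for \<mu>
    by (rule max.coboundedI1, rule cSUP_upper[OF that])
      (auto intro!: bdd_aboveI[of _ 1] ER_le_1 simp: up_def)
  have down_le: "down \<mu> \<le> ?M" if "\<mu> \<in> {1 - q..1}" for \<mu>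
    by (rule max.coboundedI2, rule cSUP_upper[OF that])
      (auto intro!: bdd_aboveI[of _ 1] ER_le_1 simp: down_def)

  have ER_le: "?ER F\<^sub>0 F \<le> ?M" if F0: "F\<^sub>0 \<in> Delta" and "F \<in> feasible F\<^sub>0" for F\<^sub>0 F
  proof -
    have F: "F \<in> {1..n} \<rightarrow> Delta"
      and dist: "\<And>i. i \<in> {1..n} \<Longrightarrow> kolmogorov_dist F\<^sub>0 (F i) \<le> ?d i"
      using that by (auto simp: feasible_def)
    let ?N = "Pi\<^sub>M {1..n} F \<bind> \<pi> xs"
    have N: "?N \<in> Delta" by (rule action_law_in_Delta[OF pol xs F])
    have "mixed_regret c\<^sub>o c\<^sub>u ?N F\<^sub>0 \<le> ?M"
    proof (rule mixed_regret_le[OF N F0])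
      fix t
      define f where "f = cdf_unit F\<^sub>0 t"
      define p where "p = (\<lambda>i\<in>{1..n}. cdf_unit (F i) t)"
      have cdf: "cdf_unit ?N t = P p"
        unfolding cdf_unit_def[of ?N] p_def using P F by (auto simp: separable_via_def)
      have f: "0 \<le> f" "f \<le> 1" "?clip (1 - f) = 1 - f"
        using cdf_unit_bounds[OF F0] by (auto simp: f_def)
      have p: "p \<in> {1..n} \<rightarrow>\<^sub>E {0..1}"
        using F cdf_unit_bounds by (auto simp: p_def Pi_iff)
      have close: "\<bar>f - p i\<bar> \<le> ?d i" and pi: "0 \<le> p i" "p i \<le> 1" if "i \<in> {1..n}" for i
        using abs_cdf_unit_diff_le_kolmogorov_dist[OF F0, of "F i" t] dist[OF that] F that p
        by (auto simp: f_def p_def Pi_iff PiE_iff)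
      show "regret_density c\<^sub>u (cdf_unit ?N t) (cdf_unit F\<^sub>0 t) \<le> ?M"
      proof (cases "q \<le> f")
        case True
        \<comment> \<open>Here the density is antitone in \<open>P p\<close>. The least value
          allowed for \<open>p i\<close> is \<open>max (f - ?d i) 0\<close>, attained by the
          Bernoulli law of mean \<open>1 - f + ?d i\<close>; moreover \<open>1 - f\<close> lies in
          \<open>{0..1 - q}\<close>.\<close>
        have "P (\<lambda>i\<in>{1..n}. 1 - ?clip (1 - f + ?d i)) \<le> P p"
        proof (rule coordinatewise_mono_le[OF mono _ p])
          fix i assume "i \<in> {1..n}"
          then show "(\<lambda>i\<in>{1..n}. 1 - ?clip (1 - f + ?d i)) i \<le> p i"
            using close[of i] pi[of i] by (auto simp: min_def max_def)
        qed auto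
        then have "regret_density q (P p) f \<le> up (1 - f)"
          unfolding up_def bernoulli
          using regret_density_antimono[OF True] by (simp add: f q)
        also have "\<dots> \<le> ?M"
          using True f by (intro up_le) auto
        finally show ?thesis by (simp add: cdf f_def q del: One_nat_def)
      next
        case False
        \<comment> \<open>Symmetrically, the density is monotone in \<open>P p\<close>, the greatest
          value allowed is \<open>min (f + ?d i) 1\<close>, and \<open>1 - f\<close> lies in
          \<open>{1 - q..1}\<close>.\<close>
        have "P p \<le> P (\<lambda>i\<in>{1..n}. 1 - ?clip (1 - f - ?d i))"
        proof (rule coordinatewise_mono_le[OF mono p])
          fix i assume "i \<in> {1..n}"
          then show "p i \<le> (\<lambda>i\<in>{1..n}. 1 - ?clip (1 - f - ?d i)) i"
            using close[of i] pi[of i] by (auto simp: min_def max_def)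
        qed auto
        then have "regret_density q (P p) f \<le> down (1 - f)"
          unfolding down_def bernoulli
          using regret_density_mono[of f q] False by (simp add: f q)
        also have "\<dots> \<le> ?M"
          using False f by (intro down_le) auto
        finally show ?thesis by (simp add: cdf f_def q del: One_nat_def)
      qed
    qed (use c in auto)
    then show ?thesis
      by (simp add: expected_regret_eq_mixed_regret[OF pol xs F F0 c(3)])
  qed

  \<comment> \<open>Used with \<open>\<nu> i\<close> equal to \<open>\<mu>\<close> plus or minus
    \<open>?d i\<close>, for the lower bound on the worst case.\<close>
  have bernoulli_feasible:
    "(\<lambda>i. bernoulli_dist (\<nu> i)) \<in> feasible (bernoulli_dist \<mu>)"
    if "\<And>i. \<bar>\<mu> - \<nu> i\<bar> \<le> ?d i" for \<mu> \<nu>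
    using order_trans[OF kolmogorov_dist_bernoulli_dist_le that]
    by (simp add: feasible_def bernoulli_dist_in_Delta)
  \<comment> \<open>The constant family has distance 0 and \<open>d\<close> is nonnegative;
    \<open>cSUP_least\<close> requires a nonempty index set.\<close>
  have feasible_nonempty: "feasible F\<^sub>0 \<noteq> {}" if "F\<^sub>0 \<in> Delta" for F\<^sub>0
  proof -
    have "(\<lambda>_. F\<^sub>0) \<in> feasible F\<^sub>0"
      using that assms(5) by (simp add: feasible_def kolmogorov_dist_def)
    then show ?thesis by blast
  qed
  have inner_le: "(SUP F\<in>feasible F\<^sub>0. ?ER F\<^sub>0 F) \<le> ?M" if "F\<^sub>0 \<in> Delta" for F\<^sub>0
    using that by (intro cSUP_least feasible_nonempty ER_le)
  have wcr: "worst_case_regret c\<^sub>o c\<^sub>u d n \<pi> xs = (SUP F\<^sub>0\<in>Delta. SUP F\<in>feasible F\<^sub>0. ?ER F\<^sub>0 F)"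
    by (simp add: worst_case_regret_def feasible_def)
  \<comment> \<open>The bound \<open>?M\<close> also supplies the boundedness under which both
    nested suprema dominate each instance.\<close>
  have ge: "?ER F\<^sub>0 F \<le> worst_case_regret c\<^sub>o c\<^sub>u d n \<pi> xs"
    if "F\<^sub>0 \<in> Delta" "F \<in> feasible F\<^sub>0" for F\<^sub>0 F
  proof -
    have "?ER F\<^sub>0 F \<le> (SUP F\<in>feasible F\<^sub>0. ?ER F\<^sub>0 F)"
      using that by (intro cSUP_upper bdd_aboveI2[of _ _ ?M] ER_le)
    also have "\<dots> \<le> (SUP F\<^sub>0\<in>Delta. SUP F\<in>feasible F\<^sub>0. ?ER F\<^sub>0 F)"
      using that(1) by (intro cSUP_upper bdd_aboveI2[of _ _ ?M] inner_le)
    finally show ?thesis by (simp add: wcr)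
  qed
  have "worst_case_regret c\<^sub>o c\<^sub>u d n \<pi> xs = ?M"
  proof (rule antisym)
    show "worst_case_regret c\<^sub>o c\<^sub>u d n \<pi> xs \<le> ?M"
      unfolding wcr using bernoulli_dist_in_Delta by (intro cSUP_least inner_le) auto
    \<comment> \<open>Every instance in either supremum is feasible, and
      \<open>0 \<le> q \<le> 1\<close> makes both intervals of means nonempty.\<close>
    show "?M \<le> worst_case_regret c\<^sub>o c\<^sub>u d n \<pi> xs"
      unfolding up_def down_def
      by (intro max.boundedI cSUP_least ge bernoulli_dist_in_Delta bernoulli_feasible)
        (use q assms(5) in auto)
  qed
  then show ?thesis
    by (simp add: up_def down_def)
qed

end
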